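(* Let $d\ge e\ge 0$ be integers and let $\alpha_0,\dots,\alpha_d,\beta_0,\dots,\beta_e$ be distinct positive integers with $$\alpha_d \mid \alpha_{d-1} \mid \cdots \mid \alpha_e \mid \beta_e \mid \alpha_{e-1} \mid \beta_{e-1} \mid \cdots \mid \alpha_0 \mid \beta_0 .$$ Let $$\Delta_1 = \operatorname{conv}\left\{\left(\tfrac{1}{\alpha_0},0,\dots,0\right),\left(0,\tfrac{1}{\alpha_1},0,\dots,0\right),\dots,\left(0,\dots,0,\tfrac{1}{\alpha_d}\right)\right\}\subset\mathbb{R}^{d+1},$$ $$\Delta_2 = \operatorname{conv}\left\{\left(\tfrac{1}{\beta_0},0,\dots,0\right),\left(0,\tfrac{1}{\beta_1},0,\dots,0\right),\dots,\left(0,\dots,0,\tfrac{1}{\beta_e}\right)\right\}\subset\mathbb{R}^{e+1}.$$ Write $L_{\Delta_1}(k)=\sum_{j=0}^d a_j(k)k^j$ and $L_{\Delta_2}(k)=\sum_{j=0}^e b_j(k)k^j$ for their Ehrhart quasi-polynomials, and let $\hat\alpha_j$ and $\hat\beta_j$ denote the minimum periods of $a_j$ and $b_j$, respectively. Let $C(k)=\sum_{m=0}^k L_{\Delta_1}(k-m)\,L_{\Delta_2}(m)$ be the convolution of $L_{\Delta_1}$ and $L_{\Delta_2}$, write $C(k)=\sum_{j=0}^{d+e+1}c_j(k)k^j$ with $c_j$ periodic, and let $\gamma_j$ be the minimum period of $c_j$. Put $g_{-1}=1$ and, for $0\le j\le d+e$, $$g_j=\operatorname{lcm}\{\gcd(\hat\alpha_i,\hat\beta_{j-i})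 : 0\le i\le d,\ 0\le j-i\le e\}.$$ Then for every $j$ with $-1\le j\le d+e$, $$\gamma_{j+1} = \operatorname{lcm}\{\hat\alpha_{j+1},\dots,\hat\alpha_d,\ \hat\beta_{j+1},\dots,\hat\beta_e,\ g_j\}.$$
   Context: A quasi-polynomial is a function on $\mathbb{Z}$ of the form $q(k) = c_d(k)k^d + \dots + c_0(k)$ where $c_0,\dots,c_d$ are periodic functions of $k\in\mathbb{Z}$, called the coefficient functions of $q$ (they are uniquely determined by $q$, even by its values at positive integers). The minimum period of a periodic function $c$ on $\mathbb{Z}$ is the smallest positive integer $p$ with $c(k+p)=c(k)$ for all $k\in\mathbb{Z}$. For a rational polytope $\mathcal{P}\subset\mathbb{R}^n$ (convex hull of finitely many points of $\mathbb{Q}^n$) of dimension $d$, Ehrhart's theorem states that $L_{\mathcal{P}}(k):=\#(k\mathcal{P}\cap\mathbb{Z}^n)$, $k\in\mathbb{Z}_{>0}$, agrees with a (unique) quasi-polynomial of degree $d$, called the Ehrhart quasi-polynomial of $\mathcal{P}$ and again denoted $L_{\mathcal{P}}$; it is evaluated at $k=0$ as a quasi-polynomial. The convolution of quasi-polynomials $A$ and $B$ of degrees $d$ and $e$ is $C(k)=\sum_{m=0}^k A(k-m)B(m)$ for $k\ge 0$; it agrees for $k\ge0$ with a unique quasi-polynomial, of the form $\sum_{j=0}^{d+e+1}c_j(k)k^j$, and its coefficient functions $c_j$ are those of this quasi-polynomial. In the final formula, a list $\hat\alpha_{j+1},\dots,\hat\alpha_d$ (resp. $\hat\beta_{j+1},\dots,\hat\beta_e$)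 is empty when $j+1>d$ (resp. $j+1>e$). *)

theory Defs
  imports "HOL-Analysis.Analysis" "HOL-Computational_Algebra.Polynomial"
begin

definition is_periodic :: "(int \<Rightarrow> real) \<Rightarrow> bool" where
  "is_periodic c \<longleftrightarrow> (\<exists>p::nat. p > 0 \<and> (\<forall>k. c (k + int p) = c k))"

definition min_period :: "(int \<Rightarrow> real) \<Rightarrow> nat" where
  "min_period c = (LEAST p. p > 0 \<and> (\<forall>k. c (k + int p) = c k))"

(* A coefficient family is indexed by all of nat and vanishes identically
   beyond some index, so that it is determined by q. *)
definition is_qp_expansion :: "(nat \<Rightarrow> int \<Rightarrow> real) \<Rightarrow> (int \<Rightarrow> real) \<Rightarrow> bool" where
  "is_qp_expansion c q \<longleftrightarrow>
     (\<forall>j. is_periodic (c j)) \<and>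
     (\<exists>d. (\<forall>j>d. c j = (\<lambda>_. 0)) \<and> (\<forall>k. q k = (\<Sum>j\<le>d. c j k * of_int k ^ j)))"

definition quasi_polynomial :: "(int \<Rightarrow> real) \<Rightarrow> bool" where
  "quasi_polynomial q \<longleftrightarrow> (\<exists>c. is_qp_expansion c q)"

definition qp_coeff :: "(int \<Rightarrow> real) \<Rightarrow> nat \<Rightarrow> int \<Rightarrow> real" where
  "qp_coeff q = (THE c. is_qp_expansion c q)"

definition lattice_point_count :: "(real ^ 'n) set \<Rightarrow> nat \<Rightarrow> nat" where
  "lattice_point_count P k = card {x \<in> (\<lambda>y. real k *\<^sub>R y) ` P. \<forall>i. x $ i \<in> \<int>}"

(* Only positive dilates are prescribed; the value at 0 is that of the quasi-polynomial. *)
definition ehrhart_qp :: "(real ^ 'n) set \<Rightarrow> int \<Rightarrow> real" where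
  "ehrhart_qp P =
     (THE q. quasi_polynomial q \<and> (\<forall>k::nat. k > 0 \<longrightarrow> q (int k) = real (lattice_point_count P k)))"

definition qp_convolution :: "(int \<Rightarrow> real) \<Rightarrow> (int \<Rightarrow> real) \<Rightarrow> int \<Rightarrow> real" where
  "qp_convolution A B =
     (THE C. quasi_polynomial C \<and> (\<forall>k::nat. C (int k) = (\<Sum>m=0..k. A (int k - int m) * B (int m))))"

text \<open>The descriptions above denote at most one object: a quasi-polynomial and its
  coefficient functions are determined by the values at positive integers.\<close>

lemma periodic_add_mult:
  fixes c :: "int \<Rightarrow> real"
  assumes "\<And>k. c (k + int p) = c k"
  shows "c (k + int n * int p) = c k"
proof (induction n)
  case (Suc n)
  have "c (k + int (Suc n) * int p) = c ((k + int n * int p) + int p)"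
    by (simp add: algebra_simps)
  then show ?case using assms Suc by simp
qed simp

lemma qp_expansion_unique_pos:
  assumes c: "is_qp_expansion c q" and c': "is_qp_expansion c' q'"
    and eq: "\<And>k. k > 0 \<Longrightarrow> q k = q' k"
  shows "c = c'"
proof -
  obtain d1 where d1: "\<forall>j>d1. c j = (\<lambda>_. 0)" "\<forall>k. q k = (\<Sum>j\<le>d1. c j k * of_int k ^ j)"
    using c unfolding is_qp_expansion_def by blast
  obtain d2 where d2: "\<forall>j>d2. c' j = (\<lambda>_. 0)" "\<forall>k. q' k = (\<Sum>j\<le>d2. c' j k * of_int k ^ j)"
    using c' unfolding is_qp_expansion_def by blast
  define D where "D = max d1 d2"
  have q: "q k = (\<Sum>j\<le>D. c j k * of_int k ^ j)" for k
    unfolding d1(2)[rule_format]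
    by (rule sum.mono_neutral_left) (use d1(1) in \<open>auto simp: D_def\<close>)
  have q': "q' k = (\<Sum>j\<le>D. c' j k * of_int k ^ j)" for k
    unfolding d2(2)[rule_format]
    by (rule sum.mono_neutral_left) (use d2(1) in \<open>auto simp: D_def\<close>)
  have "\<exists>p. \<forall>j. p j > 0 \<and> (\<forall>k. c j (k + int (p j)) = c j k)"
    using c unfolding is_qp_expansion_def is_periodic_def by metis
  then obtain p where p: "\<And>j. p j > (0::nat)" "\<And>j k. c j (k + int (p j)) = c j k" by blast
  have "\<exists>p. \<forall>j. p j > 0 \<and> (\<forall>k. c' j (k + int (p j)) = c' j k)"
    using c' unfolding is_qp_expansion_def is_periodic_def by metis
  then obtain p' where p': "\<And>j. p' j > (0::nat)" "\<And>j k. c' j (k + int (p' j)) = c' j k" by blast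
  define N where "N = (\<Prod>j\<le>D. p j) * (\<Prod>j\<le>D. p' j)"
  have N: "N > 0" by (simp add: N_def p(1) p'(1))
  have per: "c j (k + int n * int N) = c j k" if "j \<le> D" for j k n
  proof -
    have "p j dvd N" unfolding N_def using that by (intro dvd_mult2 dvd_prodI) auto
    then obtain m where "N = m * p j" by (metis dvd_def mult.commute)
    then have "int n * int N = int (n * m) * int (p j)" by simp
    then show ?thesis using periodic_add_mult[of "c j", OF p(2)] by presburger
  qed
  have per': "c' j (k + int n * int N) = c' j k" if "j \<le> D" for j k n
  proof -
    have "p' j dvd N" unfolding N_def using that by (intro dvd_mult dvd_prodI) auto
    then obtain m where "N = m * p' j" by (metis dvd_def mult.commute)
    then have "int n * int N = int (n * m) * int (p' j)" by simp
    then show ?thesis using periodic_add_mult[of "c' j", OF p'(2)] by presburger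
  qed
  have "c j k = c' j k" for j k
  proof (cases "j \<le> D")
    case True
    define R where "R = (\<Sum>j\<le>D. monom (c j k - c' j k) j)"
    define f where "f n = (of_int (k + int n * int N) :: real)" for n
    have root: "poly R (f n) = 0" if n: "n > nat \<bar>k\<bar>" for n
    proof -
      have "int n * 1 \<le> int n * int N" using N by (intro mult_left_mono) auto
      then have "k + int n * int N > 0" using n by linarith
      then have "q (k + int n * int N) = q' (k + int n * int N)" by (rule eq)
      then show ?thesis
        by (simp add: q q' R_def f_def poly_sum poly_monom per per' left_diff_distrib sum_subtractf)
    qed
    have "inj f" using N by (auto simp: f_def inj_def)
    then have "infinite (f ` {nat \<bar>k\<bar><..})"
      by (metis finite_imageD infinite_Ioi inj_on_subset subset_UNIV)
    moreover have "f ` {nat \<bar>k\<bar><..} \<subseteq> {x. poly R x = 0}" using root by auto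
    ultimately have "R = 0" using poly_roots_finite finite_subset by blast
    then have "coeff R j = 0" by simp
    then show ?thesis using True by (simp add: R_def coeff_sum)
  next
    case False
    then show ?thesis using d1(1) d2(1) by (simp add: D_def)
  qed
  then show ?thesis by blast
qed

lemma qp_coeff_eq:
  assumes "is_qp_expansion c q"
  shows "qp_coeff q = c"
  unfolding qp_coeff_def using assms qp_expansion_unique_pos by blast

lemma quasi_polynomial_eqI:
  assumes "quasi_polynomial q" "quasi_polynomial q'" "\<And>k. k > 0 \<Longrightarrow> q k = q' k"
  shows "q = q'"
proof -
  obtain c c' where c: "is_qp_expansion c q" and c': "is_qp_expansion c' q'"
    using assms(1,2) unfolding quasi_polynomial_def by blast
  have cc: "c = c'" using qp_expansion_unique_pos[OF c c' assms(3)] .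
  obtain d1 where d1: "\<forall>j>d1. c j = (\<lambda>_. 0)" "\<forall>k. q k = (\<Sum>j\<le>d1. c j k * of_int k ^ j)"
    using c unfolding is_qp_expansion_def by blast
  obtain d2 where d2: "\<forall>j>d2. c j = (\<lambda>_. 0)" "\<forall>k. q' k = (\<Sum>j\<le>d2. c j k * of_int k ^ j)"
    using c' cc unfolding is_qp_expansion_def by blast
  have "(\<Sum>j\<le>d1. c j k * of_int k ^ j) = (\<Sum>j\<le>max d1 d2. c j k * of_int k ^ j)" for k
    by (rule sum.mono_neutral_left) (use d1(1) in auto)
  moreover have "(\<Sum>j\<le>d2. c j k * of_int k ^ j) = (\<Sum>j\<le>max d1 d2. c j k * of_int k ^ j)" for k
    by (rule sum.mono_neutral_left) (use d2(1) in auto)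
  ultimately show ?thesis using d1(2) d2(2) by auto
qed

lemma ehrhart_qp_eq:
  assumes "quasi_polynomial q" "\<And>k::nat. k > 0 \<Longrightarrow> q (int k) = real (lattice_point_count P k)"
  shows "ehrhart_qp P = q"
  unfolding ehrhart_qp_def
proof (rule the_equality)
  show "quasi_polynomial q \<and> (\<forall>k>0. q (int k) = real (lattice_point_count P k))"
    using assms by blast
  show "q' = q" if "quasi_polynomial q' \<and> (\<forall>k>0. q' (int k) = real (lattice_point_count P k))" for q'
    using that assms by (intro quasi_polynomial_eqI) (auto dest!: zero_less_imp_eq_int)
qed

lemma qp_convolution_eq:
  assumes "quasi_polynomial C" "\<And>k::nat. C (int k) = (\<Sum>m=0..k. A (int k - int m) * B (int m))"
  shows "qp_convolution A B = C"
  unfolding qp_convolution_def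
proof (rule the_equality)
  show "quasi_polynomial C \<and> (\<forall>k. C (int k) = (\<Sum>m=0..k. A (int k - int m) * B (int m)))"
    using assms by blast
  show "C' = C" if "quasi_polynomial C' \<and> (\<forall>k. C' (int k) = (\<Sum>m=0..k. A (int k - int m) * B (int m)))" for C'
    using that assms by (intro quasi_polynomial_eqI) (auto dest!: zero_less_imp_eq_int)
qed

end

theory Submission
  imports Defs
begin

text \<open>
  The counting functions of \<open>\<Delta>1\<close> and \<open>\<Delta>2\<close> have generating functions
  \<open>\<Prod>i. 1 / (1 - X ^ \<alpha> i)\<close> and \<open>\<Prod>i. 1 / (1 - X ^ \<beta> i)\<close>, so their convolution belongs to the
  merged family of denominators, which is again a strict divisor chain
  \<open>\<delta> N dvd \<dots> dvd \<delta> 0\<close>. For such a chain the coefficients are \<open>\<Sum>\<lambda>. \<lambda> ^ k * P \<lambda> k\<close>, the sum running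
  over the roots of unity \<open>\<lambda>\<close> of order dividing \<open>\<delta> 0\<close>, where \<open>degree (P \<lambda>) + 1\<close> is the number of \<open>i\<close>
  with \<open>\<lambda> ^ \<delta> i = 1\<close>. Starting from the largest part \<open>\<delta> 0\<close> makes every \<open>P \<lambda>\<close> nonzero at once, so each
  further part raises the degree of exactly those \<open>P \<lambda>\<close> with \<open>\<lambda> ^ \<delta> i = 1\<close>. Hence the \<open>j\<close>-th
  coefficient function involves only \<open>\<lambda>\<close> with \<open>\<lambda> ^ \<delta> j = 1\<close>, and does involve the primitive ones:
  its minimum period is \<open>\<delta> j\<close>. The formula for \<open>\<gamma>\<close> is then a statement about positions in the
  merged chain, where gcd is the larger of two positions and lcm the smallest one.
\<close>

section \<open>Characters modulo \<open>M\<close> and finite Fourier inversion\<close>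

text \<open>The integer argument admits negative exponents, so that inverse characters need no
  division.\<close>

definition unity_char :: "nat \<Rightarrow> int \<Rightarrow> complex" where
  "unity_char M t = cis (2 * pi * of_int t / of_nat M)"

lemma unity_char_add: "unity_char M (s + t) = unity_char M s * unity_char M t"
  by (simp add: unity_char_def cis_mult distrib_left add_divide_distrib)

lemma unity_char_0 [simp]: "unity_char M 0 = 1"
  by (simp add: unity_char_def)

lemma unity_char_eq_1_iff:
  assumes "M > 0"
  shows "unity_char M t = 1 \<longleftrightarrow> int M dvd t"
proof
  assume "unity_char M t = 1"
  then have "cos (2 * pi * of_int t / of_nat M) = 1"
    by (simp add: unity_char_def complex_eq_iff)
  then obtain n :: int where "2 * pi * of_int t / of_nat M = of_int n * 2 * pi"
    using cos_one_2pi_int by blast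
  then have "real_of_int t = real_of_int (n * int M)"
    using assms by (simp add: field_simps)
  then show "int M dvd t"
    by (simp only: of_int_eq_iff) simp
next
  assume "int M dvd t"
  then obtain n where "t = int M * n" by blast
  then have "2 * pi * of_int t / of_nat M = 2 * pi * real_of_int n"
    using assms by simp
  then show "unity_char M t = 1"
    unfolding unity_char_def by (metis cis_multiple_2pi Ints_of_int)
qed

lemma unity_char_of_nat_mult: "unity_char M (int l * t) = unity_char M t ^ l"
  by (induction l) (simp_all add: distrib_right unity_char_add)

text \<open>A geometric sum whose ratio is an \<open>M\<close>-th root of unity; this orthogonality
  is what isolates single frequencies below.\<close>

lemma sum_unity_char:
  assumes "M > 0"
  shows "(\<Sum>l<M. unity_char M (int l * t)) = (if int M dvd t then of_nat M else 0)"
proof (cases "int M dvd t")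
  case True
  then show ?thesis by (simp add: unity_char_of_nat_mult unity_char_eq_1_iff[OF assms, THEN iffD2])
next
  case False
  then have "unity_char M t \<noteq> 1" by (simp add: unity_char_eq_1_iff assms)
  moreover have "unity_char M t ^ M = 1"
    by (simp add: unity_char_of_nat_mult[symmetric] unity_char_eq_1_iff assms)
  ultimately show ?thesis using False
    by (simp add: unity_char_of_nat_mult geometric_sum)
qed

text \<open>Multiplying by the inverse of the character of index \<open>r\<close> and summing over
  \<open>k < M\<close> kills every other term, by orthogonality.\<close>

lemma unity_char_independent:
  assumes "M > 0" and zero: "\<And>k::nat. (\<Sum>l<M. a l * unity_char M (int l * int k)) = 0"
    and "r < M"
  shows "a r = 0"
proof -
  have "0 = (\<Sum>k<M. unity_char M (- (int r * int k)) * (\<Sum>l<M. a l * unity_char M (int l * int k)))"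
    by (simp add: zero)
  also have "\<dots> = (\<Sum>l<M. a l * (\<Sum>k<M. unity_char M (int k * (int l - int r))))"
    unfolding sum_distrib_left
    by (subst sum.swap, intro sum.cong refl)
      (simp add: right_diff_distrib mult.commute mult.left_commute flip: unity_char_add)
  also have "\<dots> = (\<Sum>l<M. if l = r then of_nat M * a l else 0)"
  proof (intro sum.cong refl)
    fix l assume "l \<in> {..<M}"
    then have "int M dvd int l - int r \<longleftrightarrow> l = r"
      using \<open>r < M\<close> by (metis lessThan_iff mod_eq_dvd_iff mod_less of_nat_eq_iff of_nat_mod)
    then show "a l * (\<Sum>k<M. unity_char M (int k * (int l - int r))) = (if l = r then of_nat M * a l else 0)"
      by (simp add: sum_unity_char assms)
  qed
  also have "\<dots> = of_nat M * a r" using \<open>r < M\<close> by simp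
  finally show ?thesis using \<open>M > 0\<close> by simp
qed

text \<open>Finite Fourier inversion. It is done modulo \<open>M\<close> rather than modulo the
  period \<open>m\<close>, so that all series of the later induction share one index set;
  \<open>m\<close>-periodicity then confines the frequencies to those \<open>l\<close> with
  \<open>M dvd l * m\<close>.\<close>

lemma unity_char_expansion:
  fixes h :: "nat \<Rightarrow> complex"
  assumes "M > 0" "m > 0" "m dvd M" and per: "\<And>k. h (k + m) = h k"
  obtains b where "\<And>k. h k = (\<Sum>l<M. b l * unity_char M (int l * int k))"
    and "\<And>l. l < M \<Longrightarrow> \<not> M dvd l * m \<Longrightarrow> b l = 0"
proof -
  have per_n: "h (k + n * m) = h k" for k n
    by (induction n) (simp_all add: per add.assoc[symmetric] add.commute[of m])
  have h_mod: "h (k mod M) = h k" for k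
  proof -
    obtain q where "M = q * m" using \<open>m dvd M\<close> by (metis dvd_def mult.commute)
    then have "k = k mod M + (k div M * q) * m"
      by (metis mod_mult_div_eq mult.assoc mult.commute)
    then show ?thesis using per_n by metis
  qed
  define b where "b l = (\<Sum>r<M. h r * unity_char M (- (int l * int r))) / of_nat M" for l :: nat
  have b: "h k = (\<Sum>l<M. b l * unity_char M (int l * int k))" for k
  proof -
    have "(\<Sum>l<M. b l * unity_char M (int l * int k))
        = (\<Sum>l<M. \<Sum>r<M. h r / of_nat M * unity_char M (int l * (int k - int r)))"
      by (simp add: b_def sum_divide_distrib sum_distrib_right right_diff_distrib mult.assoc flip: unity_char_add)
    also have "\<dots> = (\<Sum>r<M. h r / of_nat M * (\<Sum>l<M. unity_char M (int l * (int k - int r))))"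
      by (subst sum.swap) (simp add: sum_distrib_left)
    also have "\<dots> = (\<Sum>r<M. if r = k mod M then h r else 0)"
    proof (intro sum.cong refl)
      fix r assume "r \<in> {..<M}"
      then have "int M dvd int k - int r \<longleftrightarrow> r = k mod M"
        by (metis lessThan_iff mod_eq_dvd_iff mod_less of_nat_eq_iff of_nat_mod)
      then show "h r / of_nat M * (\<Sum>l<M. unity_char M (int l * (int k - int r)))
          = (if r = k mod M then h r else 0)"
        using \<open>M > 0\<close> by (simp add: sum_unity_char)
    qed
    also have "\<dots> = h k" using \<open>M > 0\<close> by (simp add: h_mod)
    finally show ?thesis ..
  qed
  show thesis
  proof (rule that[OF b])
    fix l assume l: "l < M" "\<not> M dvd l * m"
    \<comment> \<open>A shift by \<open>m\<close> multiplies the coefficient at \<open>l\<close> by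
      \<open>unity_char M (l * m)\<close>. As \<open>h\<close> is unchanged, independence forces
      this value to be 1 or \<open>b l\<close> to be 0.\<close>
    have "(\<Sum>l<M. (b l * (unity_char M (int l * int m) - 1)) * unity_char M (int l * int k)) = 0" for k
    proof -
      have "(\<Sum>l<M. (b l * (unity_char M (int l * int m) - 1)) * unity_char M (int l * int k))
          = (\<Sum>l<M. b l * unity_char M (int l * int (k + m)) - b l * unity_char M (int l * int k))"
        by (intro sum.cong refl) (simp add: distrib_left unity_char_add left_diff_distrib right_diff_distrib)
      also have "\<dots> = h (k + m) - h k" unfolding sum_subtractf b ..
      finally show ?thesis by (simp add: per)
    qed
    then have "b l * (unity_char M (int l * int m) - 1) = 0"
      using unity_char_independent[of M "\<lambda>l. b l * (unity_char M (int l * int m) - 1)"] \<open>M > 0\<close> l(1)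
      by blast
    then show "b l = 0"
      using l(2) \<open>M > 0\<close> by (simp add: unity_char_eq_1_iff int_dvd_int_iff flip: of_nat_mult)
  qed
qed

section \<open>Exponential polynomials under multiplication by
  \<open>1 / (1 - X ^ m)\<close>\<close>

text \<open>On leading terms the operator from \<open>Q(x)\<close> to
  \<open>Q(x) - z * Q(x - m)\<close> multiplies by \<open>1 - z\<close> if
  \<open>z \<noteq> 1\<close>; for \<open>z = 1\<close> it lowers the degree of a nonconstant
  \<open>Q\<close> by one, with factor \<open>m * degree Q\<close>. Matching the leading term of
  \<open>P\<close> by the image of a monomial leaves a remainder of smaller degree.\<close>

lemma twisted_difference_poly_surj:
  fixes P :: "'a::field_char_0 poly"
  assumes "P \<noteq> 0" "m \<noteq> 0"
  shows "\<exists>Q. Q \<noteq> 0 \<and> degree Q = degree P + (if z = 1 then 1 else 0)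
           \<and> Q - smult z (Q \<circ>\<^sub>p [:- m, 1:]) = P"
  using \<open>P \<noteq> 0\<close>
proof (induction "degree P" arbitrary: P rule: less_induct)
  case less
  define n where "n = degree P"
  define s :: nat where "s = (if z = 1 then 1 else 0)"
  \<comment> \<open>Chosen so that the image of \<open>monom \<kappa> (n + s)\<close> agrees with
    \<open>P\<close> in degree \<open>n\<close>; the factor \<open>Suc n\<close> comes from
    differencing \<open>x ^ Suc n\<close>.\<close>
  define \<kappa> where "\<kappa> = (if z = 1 then lead_coeff P / (m * of_nat (Suc n)) else lead_coeff P / (1 - z))"
  define Q0 where "Q0 = monom \<kappa> (n + s)"
  define R where "R = P - (Q0 - smult z (Q0 \<circ>\<^sub>p [:- m, 1:]))"
  have "\<kappa> \<noteq> 0" using less.prems \<open>m \<noteq> 0\<close> by (auto simp: \<kappa>_def simp del: of_nat_Suc)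
  then have Q0: "Q0 \<noteq> 0" "degree Q0 = n + s" by (simp_all add: Q0_def degree_monom_eq)
  have "Q0 \<circ>\<^sub>p [:- m, 1:] = smult \<kappa> ([:- m, 1:] ^ (n + s))"
    by (rule poly_eq_poly_eq_iff[THEN iffD1], rule ext) (simp add: Q0_def poly_pcompose poly_monom)
  moreover have coeff_power: "coeff ([:- m, 1:] ^ k) i = of_nat (k choose i) * (- m) ^ (k - i)" for k i
    by (cases "i \<le> k") (simp_all add: coeff_linear_poly_power coeff_eq_0 degree_linear_power)
  ultimately have coeff_R: "coeff R i = coeff P i
      - ((if i = n + s then \<kappa> else 0) - z * (\<kappa> * (of_nat ((n + s) choose i) * (- m) ^ (n + s - i))))" for i
    by (simp add: R_def Q0_def coeff_power)
  have R0: "coeff R i = 0" if i: "i \<ge> n" for i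
  proof -
    consider "i = n" | "i = Suc n" | "i > Suc n" using i by linarith
    then show ?thesis
    proof cases
      case 1
      then show ?thesis using \<open>m \<noteq> 0\<close>
        by (auto simp: coeff_R s_def \<kappa>_def n_def field_simps simp del: of_nat_Suc)
    qed (auto simp: coeff_R s_def n_def coeff_eq_0)
  qed
  show ?case
  proof (cases "R = 0")
    case True
    then show ?thesis using Q0 by (intro exI[of _ Q0]) (auto simp: R_def s_def n_def)
  next
    case False
    then have "degree R < n" using R0 by (metis leading_coeff_0_iff linorder_not_less)
    then obtain Q1 where Q1: "degree Q1 = degree R + s" "Q1 - smult z (Q1 \<circ>\<^sub>p [:- m, 1:]) = R"
      using less.hyps[of R] False by (auto simp: n_def s_def)
    have "degree (Q0 + Q1) = n + s"
      using Q0 Q1(1) \<open>degree R < n\<close> by (subst degree_add_eq_left) auto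
    moreover have "Q0 + Q1 \<noteq> 0"
      using \<open>degree R < n\<close> calculation by force
    moreover have "(Q0 + Q1) - smult z ((Q0 + Q1) \<circ>\<^sub>p [:- m, 1:]) = P"
    proof -
      have "(Q0 + Q1) - smult z ((Q0 + Q1) \<circ>\<^sub>p [:- m, 1:])
          = (Q0 - smult z (Q0 \<circ>\<^sub>p [:- m, 1:])) + (Q1 - smult z (Q1 \<circ>\<^sub>p [:- m, 1:]))"
        by (simp add: pcompose_add smult_add_right)
      then show ?thesis unfolding Q1(2) by (simp add: R_def)
    qed
    ultimately show ?thesis by (intro exI[of _ "Q0 + Q1"]) (auto simp: s_def n_def)
  qed
qed

definition geom_fps :: "nat \<Rightarrow> real fps" where
  "geom_fps m = Abs_fps (\<lambda>k. if m dvd k then 1 else 0)"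

text \<open>Coefficient form of \<open>geom_fps m = 1 + X ^ m * geom_fps m\<close>: multiplication
  by this series inverts the difference with step \<open>m\<close>.\<close>

lemma fps_nth_mult_geom_fps:
  assumes "m > 0"
  shows "fps_nth (F * geom_fps m) k = fps_nth F k + (if m \<le> k then fps_nth (F * geom_fps m) (k - m) else 0)"
proof -
  have "geom_fps m = 1 + fps_X ^ m * geom_fps m"
    by (rule fps_ext) (use assms in \<open>auto simp: geom_fps_def fps_X_power_mult_nth dvd_minus_self dest: dvd_imp_le\<close>)
  then have "F * geom_fps m = F * (1 + fps_X ^ m * geom_fps m)"
    by (rule arg_cong)
  also have "\<dots> = F + fps_X ^ m * (F * geom_fps m)"
    by (simp add: distrib_left mult.left_commute)
  finally have "fps_nth (F * geom_fps m) k = fps_nth (F + fps_X ^ m * (F * geom_fps m)) k"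
    by simp
  then show ?thesis by (simp add: fps_X_power_mult_nth)
qed

text \<open>The coefficients of the product solve a difference equation with step \<open>m\<close>
  whose right-hand side is given by \<open>F\<close>. Inverting the twisted difference for each
  character yields a particular solution; the error is \<open>m\<close>-periodic and is absorbed
  into constant terms. Nonvanishing of every \<open>P l\<close> keeps the degrees exact.\<close>

lemma mult_geom_fps_exponential_polynomial:
  assumes "M > 0" "m > 0" "m dvd M" "\<And>l. l < M \<Longrightarrow> P l \<noteq> 0"
    and F: "\<And>k. complex_of_real (fps_nth F k) = (\<Sum>l<M. unity_char M (int l * int k) * poly (P l) (of_nat k))"
  obtains Q where "\<And>l. l < M \<Longrightarrow> Q l \<noteq> 0"
    and "\<And>l. l < M \<Longrightarrow> degree (Q l) = degree (P l) + (if M dvd l * m then 1 else 0)"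
    and "\<And>k. complex_of_real (fps_nth (F * geom_fps m) k)
           = (\<Sum>l<M. unity_char M (int l * int k) * poly (Q l) (of_nat k))"
proof -
  let ?z = "\<lambda>l. unity_char M (- (int l * int m))"
  have z: "?z l = 1 \<longleftrightarrow> M dvd l * m" for l
    using \<open>M > 0\<close> by (simp add: unity_char_eq_1_iff int_dvd_int_iff flip: of_nat_mult)
  have "\<forall>l\<in>{..<M}. \<exists>Q. Q \<noteq> 0 \<and> degree Q = degree (P l) + (if ?z l = 1 then 1 else 0)
           \<and> Q - smult (?z l) (Q \<circ>\<^sub>p [:- of_nat m, 1:]) = P l"
    using assms(2,4) by (intro ballI twisted_difference_poly_surj) auto
  then obtain Q where Q: "\<And>l. l < M \<Longrightarrow> Q l \<noteq> 0"
    "\<And>l. l < M \<Longrightarrow> degree (Q l) = degree (P l) + (if M dvd l * m then 1 else 0)"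
    "\<And>l. l < M \<Longrightarrow> Q l - smult (?z l) (Q l \<circ>\<^sub>p [:- of_nat m, 1:]) = P l"
    unfolding z by (metis lessThan_iff)
  define G where "G k = (\<Sum>l<M. unity_char M (int l * int k) * poly (Q l) (of_nat k))" for k
  \<comment> \<open>\<open>G\<close> is the particular solution, so \<open>h\<close> solves the
    homogeneous equation, that is, it has period \<open>m\<close>.\<close>
  define h where "h k = complex_of_real (fps_nth (F * geom_fps m) k) - G k" for k
  have per: "h (k + m) = h k" for k
  proof -
    have "G (k + m) - G k = (\<Sum>l<M. unity_char M (int l * int (k + m)) * poly (P l) (of_nat (k + m)))"
      unfolding G_def sum_subtractf[symmetric]
    proof (intro sum.cong refl)
      fix l assume "l \<in> {..<M}"
      then have "poly (P l) (of_nat (k + m)) = poly (Q l) (of_nat (k + m)) - ?z l * poly (Q l) (of_nat k)"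
        by (simp add: Q(3)[symmetric] poly_pcompose)
      moreover have "unity_char M (int l * int (k + m)) * ?z l = unity_char M (int l * int k)"
        by (simp add: distrib_left flip: unity_char_add)
      ultimately show "unity_char M (int l * int (k + m)) * poly (Q l) (of_nat (k + m))
          - unity_char M (int l * int k) * poly (Q l) (of_nat k)
          = unity_char M (int l * int (k + m)) * poly (P l) (of_nat (k + m))"
        by (metis mult.assoc right_diff_distrib)
    qed
    then have "G (k + m) - G k = complex_of_real (fps_nth F (k + m))"
      by (simp only: F)
    then show ?thesis
      using fps_nth_mult_geom_fps[OF \<open>m > 0\<close>, of F "k + m"] by (simp add: h_def algebra_simps)
  qed
  obtain b where b: "\<And>k. h k = (\<Sum>l<M. b l * unity_char M (int l * int k))"
    "\<And>l. l < M \<Longrightarrow> \<not> M dvd l * m \<Longrightarrow> b l = 0"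
    by (rule unity_char_expansion[OF \<open>M > 0\<close> \<open>m > 0\<close> \<open>m dvd M\<close>, where h = h, OF per]) (rule that)
  \<comment> \<open>The constant \<open>b l\<close> can be nonzero only where
    \<open>M dvd l * m\<close>, and there \<open>Q l\<close> has positive degree; hence adding it
    changes neither degree nor nonvanishing.\<close>
  have deg: "degree (Q l + [:b l:]) = degree (Q l) \<and> Q l + [:b l:] \<noteq> 0" if "l < M" for l
  proof (cases "M dvd l * m")
    case True
    then have "degree [:b l:] < degree (Q l)" using Q(2) that by simp
    then show ?thesis by (metis degree_0 degree_add_eq_left not_less_zero)
  next
    case False
    then show ?thesis using Q(1) b(2) that by simp
  qed
  show thesis
  proof (rule that[of "\<lambda>l. Q l + [:b l:]"])
    show "complex_of_real (fps_nth (F * geom_fps m) k)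
        = (\<Sum>l<M. unity_char M (int l * int k) * poly (Q l + [:b l:]) (of_nat k))" for k
      using b(1)[of k] by (simp add: h_def G_def distrib_left sum.distrib mult.commute algebra_simps)
  qed (use deg Q(2) in auto)
qed

text \<open>\<open>Suc (degree (P l))\<close> is the order of the pole of the product at the inverse
  of the root of unity of index \<open>l\<close>; each factor with a pole there raises it by
  one.\<close>

lemma prod_geom_fps_exponential_polynomial:
  fixes \<delta> :: "nat \<Rightarrow> nat"
  assumes "\<And>i. i \<le> N \<Longrightarrow> \<delta> i > 0" "\<And>i. i \<le> N \<Longrightarrow> \<delta> i dvd \<delta> 0"
  shows "\<exists>P. (\<forall>l<\<delta> 0. P l \<noteq> 0 \<and> Suc (degree (P l)) = card {i. i \<le> N \<and> \<delta> 0 dvd l * \<delta> i})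
           \<and> (\<forall>k. complex_of_real (fps_nth (\<Prod>i\<le>N. geom_fps (\<delta> i)) k)
                = (\<Sum>l<\<delta> 0. unity_char (\<delta> 0) (int l * int k) * poly (P l) (of_nat k)))"
  using assms
proof (induction N)
  case 0
  \<comment> \<open>Orthogonality writes the indicator of \<open>\<delta> 0 dvd k\<close> as the
    average of all characters, so each \<open>P l\<close> starts as a nonzero constant.\<close>
  have "complex_of_real (fps_nth (geom_fps (\<delta> 0)) k)
      = (\<Sum>l<\<delta> 0. unity_char (\<delta> 0) (int l * int k) * poly [:1 / of_nat (\<delta> 0):] (of_nat k))" for k
    using sum_unity_char[of "\<delta> 0" "int k"] 0(1)[of 0]
    by (simp add: geom_fps_def int_dvd_int_iff flip: sum_divide_distrib)
  moreover have "{i. i = 0 \<and> \<delta> 0 dvd l * \<delta> i} = {0}" for l by auto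
  ultimately show ?case
    using 0(1)[of 0] by (intro exI[of _ "\<lambda>_. [:1 / of_nat (\<delta> 0):]"]) simp
next
  case (Suc N)
  let ?M = "\<delta> 0"
  from Suc.IH[OF Suc.prems(1)[OF le_SucI] Suc.prems(2)[OF le_SucI]] obtain P where
    P: "\<forall>l<?M. P l \<noteq> 0 \<and> Suc (degree (P l)) = card {i. i \<le> N \<and> ?M dvd l * \<delta> i}"
    "\<forall>k. complex_of_real (fps_nth (\<Prod>i\<le>N. geom_fps (\<delta> i)) k)
        = (\<Sum>l<?M. unity_char ?M (int l * int k) * poly (P l) (of_nat k))"
    by blast
  show ?case
  proof (rule mult_geom_fps_exponential_polynomial[of ?M "\<delta> (Suc N)" P "\<Prod>i\<le>N. geom_fps (\<delta> i)"])
    fix Q assume Q: "\<And>l. l < ?M \<Longrightarrow> Q l \<noteq> 0"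
      "\<And>l. l < ?M \<Longrightarrow> degree (Q l) = degree (P l) + (if ?M dvd l * \<delta> (Suc N) then 1 else 0)"
      "\<And>k. complex_of_real (fps_nth ((\<Prod>i\<le>N. geom_fps (\<delta> i)) * geom_fps (\<delta> (Suc N))) k)
          = (\<Sum>l<?M. unity_char ?M (int l * int k) * poly (Q l) (of_nat k))"
    have "{i. i \<le> Suc N \<and> ?M dvd l * \<delta> i}
        = (if ?M dvd l * \<delta> (Suc N) then insert (Suc N) else id) {i. i \<le> N \<and> ?M dvd l * \<delta> i}" for l
      by (auto simp: le_Suc_eq)
    then have "Suc (degree (Q l)) = card {i. i \<le> Suc N \<and> ?M dvd l * \<delta> i}" if "l < ?M" for l
      using P(1) Q(2)[OF that] that by simp
    then show ?case using Q(1,3) by (intro exI[of _ Q]) simp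
  qed (use Suc.prems P in auto)
qed

section \<open>Minimum periods for a strict divisor chain\<close>

text \<open>Along the chain the indices \<open>i\<close> with \<open>M dvd l * \<delta> i\<close>
  form an initial segment, so they are exactly those up to \<open>degree (P l)\<close>. Strictness
  makes this segment end exactly at \<open>j\<close> for
  \<open>l = M div \<delta> j\<close>.\<close>

lemma prod_geom_fps_divisor_chain:
  fixes \<delta> :: "nat \<Rightarrow> nat"
  assumes pos: "\<And>i. i \<le> N \<Longrightarrow> \<delta> i > 0"
    and dvd: "\<And>i. i < N \<Longrightarrow> \<delta> (Suc i) dvd \<delta> i" and neq: "\<And>i. i < N \<Longrightarrow> \<delta> (Suc i) \<noteq> \<delta> i"
  obtains c q where "is_qp_expansion c q"
    and "\<And>k. q (int k) = fps_nth (\<Prod>i\<le>N. geom_fps (\<delta> i)) k"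
    and "\<And>j. j \<le> N \<Longrightarrow> min_period (c j) = \<delta> j"
proof -
  have chain: "\<delta> j dvd \<delta> i" if "i \<le> j" "j \<le> N" for i j
    using that 
  proof (induction j rule: dec_induct)
    case (step n)
    then show ?case using dvd[of n] by (auto intro: dvd_trans[of _ "\<delta> n"])
  qed simp
  have less: "\<delta> j < \<delta> i" if "i < j" "j \<le> N" for i j
  proof -
    have "\<delta> j \<le> \<delta> (Suc i)" using chain that pos by (intro dvd_imp_le) auto
    also have "\<delta> (Suc i) < \<delta> i"
      using dvd_imp_le[OF dvd[of i] pos[of i]] neq[of i] that by linarith
    finally show ?thesis .
  qed
  define M where "M = \<delta> 0"
  have M: "M > 0" using pos[of 0] by (simp add: M_def)
  define F where "F = (\<Prod>i\<le>N. geom_fps (\<delta> i))"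
  have "\<And>i. i \<le> N \<Longrightarrow> \<delta> i dvd \<delta> 0" using chain by blast
  from prod_geom_fps_exponential_polynomial[of N \<delta>, OF pos this]
  obtain P where P: "\<And>l. l < M \<Longrightarrow> P l \<noteq> 0"
    "\<And>l. l < M \<Longrightarrow> Suc (degree (P l)) = card {i. i \<le> N \<and> M dvd l * \<delta> i}"
    "\<And>k. complex_of_real (fps_nth F k) = (\<Sum>l<M. unity_char M (int l * int k) * poly (P l) (of_nat k))"
    unfolding M_def[symmetric] F_def[symmetric] by blast
  \<comment> \<open>Sorting the exponential polynomial by powers of \<open>k\<close> gives the
    coefficient functions, at first as complex ones.\<close>
  define C where "C j k = (\<Sum>l<M. coeff (P l) j * unity_char M (int l * k))" for j k
  have degree_le: "degree (P l) \<le> N" if "l < M" for l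
  proof -
    have "card {i. i \<le> N \<and> M dvd l * \<delta> i} \<le> card {..N}" by (rule card_mono) auto
    then show ?thesis using P(2)[OF that] by simp
  qed
  have C_zero: "C j = (\<lambda>_. 0)" if "j > N" for j
    unfolding C_def using degree_le that by (intro ext sum.neutral) (force simp: coeff_eq_0)
  have C_sum: "(\<Sum>j\<le>N. C j (int k) * of_nat k ^ j) = complex_of_real (fps_nth F k)" for k
  proof -
    have "poly (P l) (of_nat k) = (\<Sum>j\<le>N. coeff (P l) j * of_nat k ^ j)" if "l < M" for l
      unfolding poly_altdef
      by (rule sum.mono_neutral_left) (use degree_le[OF that] in \<open>auto simp: coeff_eq_0\<close>)
    then have "complex_of_real (fps_nth F k)
        = (\<Sum>l<M. \<Sum>j\<le>N. unity_char M (int l * int k) * (coeff (P l) j * of_nat k ^ j))"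
      by (simp add: P(3) sum_distrib_left)
    also have "\<dots> = (\<Sum>j\<le>N. C j (int k) * of_nat k ^ j)"
      unfolding C_def sum_distrib_right by (subst sum.swap) (simp add: mult_ac)
    finally show ?thesis ..
  qed
  have dvd_of_coeff: "M dvd l * \<delta> j" if "l < M" "j \<le> N" "coeff (P l) j \<noteq> 0" for l j
  proof (rule ccontr)
    assume "\<not> M dvd l * \<delta> j"
    then have "\<not> M dvd l * \<delta> i" if "j \<le> i" "i \<le> N" for i
      using chain[OF that] dvd_trans mult_dvd_mono[OF dvd_refl] by blast
    then have "{i. i \<le> N \<and> M dvd l * \<delta> i} \<subseteq> {..<j}"
      by (auto simp flip: not_le)
    then have "card {i. i \<le> N \<and> M dvd l * \<delta> i} \<le> j"
      using card_mono[of "{..<j}"] by simp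
    moreover have "j \<le> degree (P l)" using that(3) by (rule le_degree)
    ultimately show False using P(2)[OF that(1)] by simp
  qed
  have C_per: "C j (k + int (\<delta> j)) = C j k" if "j \<le> N" for j k
    unfolding C_def
  proof (intro sum.cong refl)
    fix l assume "l \<in> {..<M}"
    then have "coeff (P l) j \<noteq> 0 \<Longrightarrow> unity_char M (int l * int (\<delta> j)) = 1"
      using dvd_of_coeff[of l j] that M
      by (simp add: unity_char_eq_1_iff int_dvd_int_iff flip: of_nat_mult)
    then show "coeff (P l) j * unity_char M (int l * (k + int (\<delta> j))) = coeff (P l) j * unity_char M (int l * k)"
      by (cases "coeff (P l) j = 0") (simp_all add: distrib_left unity_char_add)
  qed
  have periodic: "is_periodic (\<lambda>k. f (C j k))" for f j
  proof (cases "j \<le> N")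
    case True
    then show ?thesis unfolding is_periodic_def using C_per pos by metis
  next
    case False
    then show ?thesis by (auto simp: is_periodic_def C_zero)
  qed
  define c where "c j k = Re (C j k)" for j k
  define q where "q k = (\<Sum>j\<le>N. c j k * of_int k ^ j)" for k :: int
  \<comment> \<open>The series is real, so the imaginary parts form an expansion that vanishes at
    all positive integers; by uniqueness each of them is zero.\<close>
  have "(\<lambda>j k. Im (C j k)) = (\<lambda>j k. 0)"
  proof (rule qp_expansion_unique_pos)
    show "is_qp_expansion (\<lambda>j k. Im (C j k)) (\<lambda>k. \<Sum>j\<le>N. Im (C j k) * of_int k ^ j)"
      unfolding is_qp_expansion_def using periodic C_zero by (intro conjI allI exI[of _ N]) auto
    show "is_qp_expansion (\<lambda>j k. 0) (\<lambda>k. 0)"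
      by (auto simp: is_qp_expansion_def is_periodic_def)
    fix k :: int assume "k > 0"
    then obtain n where "k = int n" by (metis zero_less_imp_eq_int)
    then show "(\<Sum>j\<le>N. Im (C j k) * of_int k ^ j) = 0"
      using arg_cong[OF C_sum[of n], of Im] by (simp flip: of_nat_power)
  qed
  then have C_real: "C j k = complex_of_real (c j k)" for j k
    by (simp add: c_def complex_eq_iff fun_eq_iff)
  show thesis
  proof (rule that)
    show "is_qp_expansion c q"
      unfolding is_qp_expansion_def c_def q_def
      using periodic C_zero by (intro conjI allI exI[of _ N]) auto
    show "q (int k) = fps_nth (\<Prod>i\<le>N. geom_fps (\<delta> i)) k" for k
      using arg_cong[OF C_sum[of k], of Re] by (simp add: q_def c_def F_def flip: of_nat_power)
    fix j assume j: "j \<le> N"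
    show "min_period (c j) = \<delta> j"
      unfolding min_period_def
    proof (rule Least_equality)
      show "\<delta> j > 0 \<and> (\<forall>k. c j (k + int (\<delta> j)) = c j k)"
        using pos C_per j by (simp add: c_def)
      fix p assume p: "p > 0 \<and> (\<forall>k. c j (k + int p) = c j k)"
      \<comment> \<open>The case \<open>\<delta> j = 1\<close> is separate because
        \<open>M div \<delta> j\<close> would then be \<open>M\<close>, outside the index range; the
        trivial character has index 0.\<close>
      have "\<delta> j dvd p"
      proof (cases "\<delta> j = 1")
        case False
        define l where "l = M div \<delta> j"
        have M_eq: "M = l * \<delta> j" using chain[of 0 j] j by (simp add: l_def M_def)
        then have l: "l < M" "l > 0" using M False pos[OF j] by auto
        \<comment> \<open>the character of index l has exact order \<delta> j, so it occurs with degree exactly j\<close>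
        have "i \<le> j" if "i \<le> N" "\<delta> j dvd \<delta> i" for i
          using less[of j i] dvd_imp_le[OF that(2) pos[OF that(1)]] that(1) by linarith
        then have "{i. i \<le> N \<and> M dvd l * \<delta> i} = {..j}"
          using l(2) chain[of _ j] j by (auto simp: M_eq)
        then have "coeff (P l) j \<noteq> 0"
          using P(1,2)[OF l(1)] by (metis Suc_inject card_atMost leading_coeff_0_iff)
        \<comment> \<open>These products are the character coefficients of the difference between
          \<open>C j\<close> shifted by \<open>p\<close> and \<open>C j\<close>, which is
          zero.\<close>
        moreover have "coeff (P l) j * (unity_char M (int l * int p) - 1) = 0"
        proof (rule unity_char_independent[OF M _ l(1)])
          fix k :: nat
          have "C j (int k + int p) - C j (int k) = 0" using p by (simp add: C_real)
          then show "(\<Sum>l<M. (coeff (P l) j * (unity_char M (int l * int p) - 1)) * unity_char M (int l * int k)) = 0"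
            by (simp add: C_def sum_subtractf[symmetric] distrib_left unity_char_add algebra_simps)
        qed
        ultimately have "M dvd l * p"
          using M by (simp add: unity_char_eq_1_iff int_dvd_int_iff flip: of_nat_mult)
        then show ?thesis using l(2) by (simp add: M_eq)
      qed simp
      then show "\<delta> j \<le> p" using p by (simp add: dvd_imp_le)
    qed
  qed
qed

section \<open>Lattice points of the simplices\<close>

text \<open>Splitting off the value at \<open>x\<close> matches the Cauchy product, whose index
  \<open>i\<close> is the contribution \<open>A x * f x\<close>. Vanishing outside \<open>S\<close>
  makes a solution determined by its values on \<open>S\<close>; finiteness is proved alongside
  because \<open>card\<close> of the dependent sum relies on it.\<close>

lemma fps_nth_prod_geom_fps:
  fixes A :: "'a \<Rightarrow> nat"
  assumes "finite S" "\<And>i. i \<in> S \<Longrightarrow> A i > 0"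
  shows "finite {f. (\<forall>i. i \<notin> S \<longrightarrow> f i = 0) \<and> (\<Sum>i\<in>S. A i * f i) = k} \<and>
    fps_nth (\<Prod>i\<in>S. geom_fps (A i)) k
      = real (card {f. (\<forall>i. i \<notin> S \<longrightarrow> f i = 0) \<and> (\<Sum>i\<in>S. A i * f i) = k})"
  using assms
proof (induction S arbitrary: k rule: finite_induct)
  case empty
  have "{f :: 'a \<Rightarrow> nat. (\<forall>i. f i = 0) \<and> k = 0} = (if k = 0 then {\<lambda>_. 0} else {})"
    by auto
  then show ?case by (auto simp: eq_commute[of 0])
next
  case (insert x S)
  let ?Sol = "\<lambda>S k. {f :: 'a \<Rightarrow> nat. (\<forall>i. i \<notin> S \<longrightarrow> f i = 0) \<and> (\<Sum>i\<in>S. A i * f i) = k}"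
  let ?I = "{i \<in> {0..k}. A x dvd i}"
  have sum_upd: "(\<Sum>i\<in>S. A i * (f(x := n)) i) = (\<Sum>i\<in>S. A i * f i)" for f :: "'a \<Rightarrow> nat" and n
    using insert.hyps by (intro sum.cong) auto
  have bij: "bij_betw (\<lambda>f. (A x * f x, f(x := 0))) (?Sol (insert x S) k) (SIGMA i:?I. ?Sol S (k - i))"
  proof (rule bij_betw_byWitness[where f' = "\<lambda>(i, f). f(x := i div A x)"])
    show "\<forall>f\<in>?Sol (insert x S) k. (\<lambda>(i, f). f(x := i div A x)) (A x * f x, f(x := 0)) = f"
      using insert.prems by simp
    show "\<forall>p\<in>(SIGMA i:?I. ?Sol S (k - i)).
        (\<lambda>f. (A x * f x, f(x := 0))) ((\<lambda>(i, f). f(x := i div A x)) p) = p"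
      using insert.hyps by (auto simp: fun_eq_iff)
    show "(\<lambda>f. (A x * f x, f(x := 0))) ` ?Sol (insert x S) k \<subseteq> (SIGMA i:?I. ?Sol S (k - i))"
      using insert.hyps by (auto simp del: fun_upd_apply simp: sum_upd) (simp_all add: fun_upd_apply)
    show "(\<lambda>(i, f). f(x := i div A x)) ` (SIGMA i:?I. ?Sol S (k - i)) \<subseteq> ?Sol (insert x S) k"
      using insert.hyps by (auto simp del: fun_upd_apply simp: sum_upd) (simp_all add: fun_upd_apply)
  qed
  have IH: "finite (?Sol S n)" "fps_nth (\<Prod>i\<in>S. geom_fps (A i)) n = real (card (?Sol S n))" for n
    using insert.IH insert.prems by auto
  have "fps_nth (\<Prod>i\<in>insert x S. geom_fps (A i)) k
      = (\<Sum>i\<in>{0..k}. if A x dvd i then real (card (?Sol S (k - i))) else 0)"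
    unfolding prod.insert[OF insert.hyps] fps_mult_nth IH(2)
    by (intro sum.cong) (simp_all add: geom_fps_def)
  also have "\<dots> = real (\<Sum>i\<in>?I. card (?Sol S (k - i)))"
    unfolding of_nat_sum by (rule sum.inter_filter[symmetric]) simp
  also have "(\<Sum>i\<in>?I. card (?Sol S (k - i))) = card (SIGMA i:?I. ?Sol S (k - i))"
    using IH(1) by simp
  also have "\<dots> = card (?Sol (insert x S) k)"
    using bij_betw_same_card[OF bij] by simp
  finally show ?case
    using bij_betw_finite[OF bij] IH(1) by simp
qed

text \<open>The barycentric coordinates of \<open>x\<close> with respect to these vertices are the
  numbers \<open>A i * x $ i\<close>.\<close>

lemma convex_hull_scaled_axes:
  fixes A :: "'n::finite \<Rightarrow> nat"
  assumes A: "\<And>i. A i > 0"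
  shows "convex hull range (\<lambda>i. axis i (1 / real (A i)))
    = {x. (\<forall>i. 0 \<le> x $ i) \<and> (\<Sum>i\<in>UNIV. real (A i) * x $ i) = 1}" (is "_ = ?T")
proof
  show "convex hull range (\<lambda>i. axis i (1 / real (A i))) \<subseteq> ?T"
  proof (rule hull_minimal)
    show "range (\<lambda>i. axis i (1 / real (A i))) \<subseteq> ?T"
    proof -
      have "real (A j) * axis i (1 / real (A i)) $ j = (if j = i then 1 else 0)" for i j
        using A[of i] by (simp add: axis_def)
      then show ?thesis by (auto simp: axis_def)
    qed
    show "convex ?T"
      by (auto simp: convex_def distrib_left sum.distrib mult.left_commute simp flip: sum_distrib_left)
  qed
next
  show "?T \<subseteq> convex hull range (\<lambda>i. axis i (1 / real (A i)))"
  proof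
    fix x assume x: "x \<in> ?T"
    have "(\<Sum>i\<in>UNIV. (real (A i) * x $ i) *\<^sub>R axis i (1 / real (A i)))
        \<in> convex hull range (\<lambda>i. axis i (1 / real (A i)))"
      using x by (intro convex_sum) (auto intro: hull_inc)
    moreover have "(\<Sum>i\<in>UNIV. (real (A i) * x $ i) *\<^sub>R axis i (1 / real (A i))) = x"
      using A by (auto simp: vec_eq_iff axis_def if_distrib cong: if_cong)
    ultimately show "x \<in> convex hull range (\<lambda>i. axis i (1 / real (A i)))" by simp
  qed
qed

text \<open>Dilation turns the right-hand side 1 of the simplex equation into \<open>k\<close>, so
  lattice points are solutions in natural numbers of a linear equation.\<close>

lemma lattice_point_count_scaled_axes:
  fixes A :: "'n::finite \<Rightarrow> nat"
  assumes A: "\<And>i. A i > 0" and "k > 0"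
  shows "real (lattice_point_count (convex hull range (\<lambda>i. axis i (1 / real (A i)))) k)
    = fps_nth (\<Prod>i\<in>UNIV. geom_fps (A i)) k"
proof -
  let ?T = "{x :: real ^ 'n. (\<forall>i. 0 \<le> x $ i) \<and> (\<Sum>i\<in>UNIV. real (A i) * x $ i) = 1}"
  have "x \<in> (\<lambda>y. real k *\<^sub>R y) ` ?T
      \<longleftrightarrow> (\<forall>i. 0 \<le> x $ i) \<and> (\<Sum>i\<in>UNIV. real (A i) * x $ i) = real k" for x
  proof
    assume "x \<in> (\<lambda>y. real k *\<^sub>R y) ` ?T"
    then show "(\<forall>i. 0 \<le> x $ i) \<and> (\<Sum>i\<in>UNIV. real (A i) * x $ i) = real k"
      by (auto simp: mult.left_commute simp flip: sum_distrib_left)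
  next
    assume x: "(\<forall>i. 0 \<le> x $ i) \<and> (\<Sum>i\<in>UNIV. real (A i) * x $ i) = real k"
    then have "(1 / real k) *\<^sub>R x \<in> ?T"
      using \<open>k > 0\<close> by (simp flip: sum_divide_distrib)
    moreover have "x = real k *\<^sub>R ((1 / real k) *\<^sub>R x)" using \<open>k > 0\<close> by simp
    ultimately show "x \<in> (\<lambda>y. real k *\<^sub>R y) ` ?T" by blast
  qed
  then have "lattice_point_count (convex hull range (\<lambda>i. axis i (1 / real (A i)))) k
      = card {x. (\<forall>i. 0 \<le> x $ i) \<and> (\<Sum>i\<in>UNIV. real (A i) * x $ i) = real k \<and> (\<forall>i. x $ i \<in> \<int>)}"
    unfolding lattice_point_count_def convex_hull_scaled_axes[OF A] by (simp add: conj_assoc)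
  also have "{x. (\<forall>i. 0 \<le> x $ i) \<and> (\<Sum>i\<in>UNIV. real (A i) * x $ i) = real k \<and> (\<forall>i. x $ i \<in> \<int>)}
      = (\<lambda>f. \<chi> i. real (f i)) ` {f. (\<Sum>i\<in>UNIV. A i * f i) = k}" (is "?L = ?R")
  proof
    show "?R \<subseteq> ?L" by auto
    show "?L \<subseteq> ?R"
    proof
      fix x assume x: "x \<in> ?L"
      define f where "f i = nat \<lfloor>x $ i\<rfloor>" for i
      have f: "x $ i = real (f i)" for i using x by (simp add: f_def)
      then have "real (\<Sum>i\<in>UNIV. A i * f i) = real k" using x by simp
      then have "(\<Sum>i\<in>UNIV. A i * f i) = k" by (simp only: of_nat_eq_iff)
      moreover have "x = (\<chi> i. real (f i))" by (simp add: vec_eq_iff f)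
      ultimately show "x \<in> ?R" by blast
    qed
  qed
  also have "card \<dots> = card {f. (\<Sum>i\<in>UNIV. A i * f i) = k}"
    by (intro card_image inj_onI) (simp add: vec_eq_iff fun_eq_iff)
  finally show ?thesis
    using fps_nth_prod_geom_fps[of UNIV A k] A by simp
qed

text \<open>Serves both simplices. The first conclusion includes \<open>k = 0\<close>, where the
  lattice point count prescribes nothing and the value is that of the quasi-polynomial; the
  convolution needs it at its end terms.\<close>

lemma ehrhart_divisor_chain:
  fixes \<alpha> :: "nat \<Rightarrow> nat" and u :: "nat \<Rightarrow> 'n::finite"
  assumes pos: "\<And>i. i \<le> d \<Longrightarrow> \<alpha> i > 0"
    and chain: "\<And>i. i < d \<Longrightarrow> \<alpha> (Suc i) dvd \<alpha> i" "inj_on \<alpha> {0..d}"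
    and u: "bij_betw u {0..d} (UNIV :: 'n set)"
    and \<Delta>: "\<Delta> = convex hull ((\<lambda>i. axis (u i) (1 / real (\<alpha> i))) ` {0..d})"
  shows "ehrhart_qp \<Delta> (int k) = fps_nth (\<Prod>i\<le>d. geom_fps (\<alpha> i)) k"
    and "i \<le> d \<Longrightarrow> min_period (qp_coeff (ehrhart_qp \<Delta>) i) = \<alpha> i"
proof -
  define A where "A = \<alpha> \<circ> inv_into {0..d} u"
  have A_u: "A (u i) = \<alpha> i" if "i \<le> d" for i
    using that u by (simp add: A_def bij_betw_def)
  have UNIV_eq: "UNIV = u ` {0..d}" using u by (simp add: bij_betw_def)
  have A_pos: "A x > 0" for x
    using UNIV_eq pos A_u by (metis UNIV_I atLeastAtMost_iff imageE)
  have "\<Delta> = convex hull range (\<lambda>x. axis x (1 / real (A x)))"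
    unfolding \<Delta> UNIV_eq image_image by (intro arg_cong[where f = "\<lambda>S. convex hull S"] image_cong) (simp_all add: A_u)
  then have count: "real (lattice_point_count \<Delta> k) = fps_nth (\<Prod>i\<le>d. geom_fps (\<alpha> i)) k" if "k > 0" for k
    using lattice_point_count_scaled_axes[OF A_pos that]
      prod.reindex_bij_betw[OF u, of "\<lambda>x. geom_fps (A x)"]
    by (simp add: A_u atMost_atLeast0)
  have "\<alpha> (Suc i) \<noteq> \<alpha> i" if "i < d" for i
    using inj_onD[OF chain(2), of "Suc i" i] that by auto
  then obtain c q where q: "is_qp_expansion c q"
    "\<And>k. q (int k) = fps_nth (\<Prod>i\<le>d. geom_fps (\<alpha> i)) k" "\<And>i. i \<le> d \<Longrightarrow> min_period (c i) = \<alpha> i"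
    using prod_geom_fps_divisor_chain[of d \<alpha>] pos chain(1) by metis
  have "ehrhart_qp \<Delta> = q"
    using q(1,2) count by (intro ehrhart_qp_eq) (auto simp: quasi_polynomial_def)
  then show "ehrhart_qp \<Delta> (int k) = fps_nth (\<Prod>i\<le>d. geom_fps (\<alpha> i)) k"
    and "i \<le> d \<Longrightarrow> min_period (qp_coeff (ehrhart_qp \<Delta>) i) = \<alpha> i"
    using q qp_coeff_eq[OF q(1)] by simp_all
qed

section \<open>The merged divisor chain\<close>

text \<open>The order is \<beta> 0, \<alpha> 0, \<beta> 1, \<alpha> 1, ..., \<beta> e, \<alpha> e,
  \<alpha> (e + 1), ..., \<alpha> d, in which, under the hypotheses of the theorem, each entry is a
  multiple of the next.\<close>

definition interleave :: "nat \<Rightarrow> (nat \<Rightarrow> nat) \<Rightarrow> (nat \<Rightarrow> nat) \<Rightarrow> nat \<Rightarrow> nat" where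
  "interleave e \<alpha> \<beta> j =
     (if 2 * e < j then \<alpha> (j - Suc e) else if even j then \<beta> (j div 2) else \<alpha> (j div 2))"

text \<open>Merging only reorders factors, so the generating function of the merged chain is that of
  the convolution.\<close>

lemma prod_interleave:
  fixes f :: "nat \<Rightarrow> 'a::comm_monoid_mult"
  assumes "e \<le> d"
  shows "(\<Prod>j\<le>Suc (d + e). f (interleave e \<alpha> \<beta> j)) = (\<Prod>i\<le>d. f (\<alpha> i)) * (\<Prod>i\<le>e. f (\<beta> i))"
proof -
  have low: "(\<Prod>j<2 * n. f (if even j then \<beta> (j div 2) else \<alpha> (j div 2)))
      = (\<Prod>i<n. f (\<alpha> i)) * (\<Prod>i<n. f (\<beta> i))" for n
    by (induction n) (simp_all add: mult_ac)
  have "{..Suc (d + e)} = {..<2 * Suc e} \<union> {2 * Suc e..Suc (d + e)}"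
    using assms by auto
  then have "(\<Prod>j\<le>Suc (d + e). f (interleave e \<alpha> \<beta> j))
      = (\<Prod>j<2 * Suc e. f (interleave e \<alpha> \<beta> j)) * (\<Prod>j=2 * Suc e..Suc (d + e). f (interleave e \<alpha> \<beta> j))"
    by (simp only:) (rule prod.union_disjoint, auto)
  also have "(\<Prod>j<2 * Suc e. f (interleave e \<alpha> \<beta> j))
      = (\<Prod>j<2 * Suc e. f (if even j then \<beta> (j div 2) else \<alpha> (j div 2)))"
  proof (intro prod.cong refl)
    fix j assume "j \<in> {..<2 * Suc e}"
    \<comment> \<open>Only \<open>j = 2 * e + 1\<close> takes the first branch here, and both
      formulas give \<open>\<alpha> e\<close>.\<close>
    moreover have "j - Suc e = j div 2 \<and> odd j" if "2 * e < j" "j < 2 * Suc e"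
    proof -
      have "j = Suc (2 * e)" using that by simp
      then show ?thesis by simp
    qed
    ultimately show "f (interleave e \<alpha> \<beta> j) = f (if even j then \<beta> (j div 2) else \<alpha> (j div 2))"
      by (auto simp: interleave_def)
  qed
  also have "\<dots> = (\<Prod>i\<le>e. f (\<alpha> i)) * (\<Prod>i\<le>e. f (\<beta> i))"
    unfolding low lessThan_Suc_atMost ..
  also have "(\<Prod>j=2 * Suc e..Suc (d + e). f (interleave e \<alpha> \<beta> j)) = (\<Prod>i=Suc e..d. f (\<alpha> i))"
    by (rule prod.reindex_bij_witness[of _ "\<lambda>i. i + Suc e" "\<lambda>j. j - Suc e"])
      (auto simp: interleave_def)
  also have "(\<Prod>i\<le>e. f (\<alpha> i)) * (\<Prod>i\<le>e. f (\<beta> i)) * (\<Prod>i=Suc e..d. f (\<alpha> i))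
      = ((\<Prod>i\<le>e. f (\<alpha> i)) * (\<Prod>i=Suc e..d. f (\<alpha> i))) * (\<Prod>i\<le>e. f (\<beta> i))"
    by (simp add: mult_ac)
  also have "(\<Prod>i\<le>e. f (\<alpha> i)) * (\<Prod>i=Suc e..d. f (\<alpha> i)) = (\<Prod>i\<le>d. f (\<alpha> i))"
    using assms by (subst prod.union_disjoint[symmetric]) (auto intro!: prod.cong simp: ivl_disj_un)
  finally show ?thesis .
qed

section \<open>Evaluation of the lcm formula by positions in the chain\<close>

text \<open>Any nonempty set of entries of a divisor chain has a member that all others divide;
  every lcm in the formula is evaluated this way.\<close>

lemma Lcm_eq_top:
  fixes n :: nat
  assumes "n \<in> S" "\<And>x. x \<in> S \<Longrightarrow> x dvd n"
  shows "Lcm S = n"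
  using assms by (intro dvd_antisym Lcm_least dvd_Lcm) auto

text \<open>The bijections \<open>u\<close> and \<open>v\<close> fix the dimensions as
  \<open>d + 1\<close> and \<open>e + 1\<close> and name the axes; \<open>j\<close> is an integer so
  that the index -1 is available. Both sides turn out to be entry \<open>j + 1\<close> of the merged
  chain.\<close>

theorem theorem7:
  fixes d e :: nat
    and \<alpha> \<beta> :: "nat \<Rightarrow> nat"
    and u :: "nat \<Rightarrow> 'n::finite" and v :: "nat \<Rightarrow> 'm::finite"
    and \<Delta>1 :: "(real ^ 'n) set" and \<Delta>2 :: "(real ^ 'm) set"
    and a b c :: "nat \<Rightarrow> int \<Rightarrow> real"
    and \<alpha>h \<beta>h \<gamma> :: "nat \<Rightarrow> nat"
    and g :: "int \<Rightarrow> nat"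
    and j :: int
  assumes "d \<ge> e"
    and "\<And>i. i \<le> d \<Longrightarrow> \<alpha> i > 0" and "\<And>i. i \<le> e \<Longrightarrow> \<beta> i > 0"
    and "inj_on \<alpha> {0..d}" and "inj_on \<beta> {0..e}" and "\<alpha> ` {0..d} \<inter> \<beta> ` {0..e} = {}"
    and "\<And>i. e \<le> i \<Longrightarrow> i < d \<Longrightarrow> \<alpha> (Suc i) dvd \<alpha> i"
    and "\<And>i. i \<le> e \<Longrightarrow> \<alpha> i dvd \<beta> i"
    and "\<And>i. i < e \<Longrightarrow> \<beta> (Suc i) dvd \<alpha> i"
    and "bij_betw u {0..d} (UNIV :: 'n set)"
    and "bij_betw v {0..e} (UNIV :: 'm set)"
    and "\<Delta>1 = convex hull ((\<lambda>i. axis (u i) (1 / real (\<alpha> i))) ` {0..d})"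
    and "\<Delta>2 = convex hull ((\<lambda>i. axis (v i) (1 / real (\<beta> i))) ` {0..e})"
    and "a = qp_coeff (ehrhart_qp \<Delta>1)"
    and "b = qp_coeff (ehrhart_qp \<Delta>2)"
    and "c = qp_coeff (qp_convolution (ehrhart_qp \<Delta>1) (ehrhart_qp \<Delta>2))"
    and "\<And>i. \<alpha>h i = min_period (a i)"
    and "\<And>i. \<beta>h i = min_period (b i)"
    and "\<And>i. \<gamma> i = min_period (c i)"
    and "g (-1) = 1"
    and "\<And>j. 0 \<le> j \<Longrightarrow> j \<le> int d + int e \<Longrightarrow>
           g j = Lcm {gcd (\<alpha>h i) (\<beta>h l) | i l. i \<le> d \<and> l \<le> e \<and> int i + int l = j}"
    and "-1 \<le> j" and "j \<le> int d + int e"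
  shows "\<gamma> (nat (j + 1)) =
           Lcm ({\<alpha>h i | i. j + 1 \<le> int i \<and> i \<le> d} \<union> {\<beta>h i | i. j + 1 \<le> int i \<and> i \<le> e} \<union> {g j})"
proof -
  note dist = assms(4-6) and dvd_high = assms(7) and dvd_\<alpha>_\<beta> = assms(8) and dvd_\<beta>_\<alpha> = assms(9)
  have \<alpha>_chain: "\<alpha> (Suc i) dvd \<alpha> i" if "i < d" for i
    using dvd_high[of i] dvd_\<alpha>_\<beta>[of "Suc i"] dvd_\<beta>_\<alpha>[of i] that
    by (cases "e \<le> i") (auto intro: dvd_trans)
  have \<beta>_chain: "\<beta> (Suc i) dvd \<beta> i" if "i < e" for i
    using dvd_\<alpha>_\<beta>[of i] dvd_\<beta>_\<alpha>[of i] that by (auto intro: dvd_trans)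
  note ehr1 = ehrhart_divisor_chain[OF assms(2) \<alpha>_chain assms(4) assms(10) assms(12)]
  note ehr2 = ehrhart_divisor_chain[OF assms(3) \<beta>_chain assms(5) assms(11) assms(13)]
  have \<alpha>h: "\<alpha>h i = \<alpha> i" if "i \<le> d" for i using ehr1(2) that assms(14,17) by simp
  have \<beta>h: "\<beta>h i = \<beta> i" if "i \<le> e" for i using ehr2(2) that assms(15,18) by simp

  \<comment> \<open>The last position: the chain has \<open>(d + 1) + (e + 1)\<close> entries,
    numbered from 0.\<close>
  define N where "N = Suc (d + e)"
  define \<delta> where "\<delta> = interleave e \<alpha> \<beta>"
  have \<delta>_\<alpha>_low: "\<delta> (Suc (2 * i)) = \<alpha> i" if "i \<le> e" for i
    using that by (cases "i = e") (auto simp: \<delta>_def interleave_def)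
  have \<delta>_\<alpha>_high: "\<delta> (Suc (i + e)) = \<alpha> i" if "e \<le> i" for i
    using that by (auto simp: \<delta>_def interleave_def)
  have \<delta>_\<beta>: "\<delta> (2 * i) = \<beta> i" if "i \<le> e" for i
    using that by (auto simp: \<delta>_def interleave_def)
  have \<delta>_cases: thesis if "n \<le> N"
    "\<And>i. i \<le> e \<Longrightarrow> n = 2 * i \<Longrightarrow> thesis" "\<And>i. i \<le> e \<Longrightarrow> n = Suc (2 * i) \<Longrightarrow> thesis"
    "\<And>i. e < i \<Longrightarrow> i \<le> d \<Longrightarrow> n = Suc (i + e) \<Longrightarrow> thesis" for n thesis
  proof (cases "n \<le> Suc (2 * e)")
    case True
    then show thesis using that(2)[of "n div 2"] that(3)[of "n div 2"] by (cases "even n") auto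
  next
    case False
    then show thesis using that(1) that(4)[of "n - Suc e"] by (simp add: N_def)
  qed
  have \<alpha>_\<beta>_neq: "\<alpha> i \<noteq> \<beta> k" if "i \<le> d" "k \<le> e" for i k
    using dist(3) imageI[of i "{0..d}" \<alpha>] imageI[of k "{0..e}" \<beta>] that by fastforce
  have \<delta>_pos: "\<delta> n > 0" if "n \<le> N" for n
    using that
  proof (rule \<delta>_cases)
  qed (use assms(1-3) in \<open>simp_all add: \<delta>_\<beta> \<delta>_\<alpha>_low \<delta>_\<alpha>_high\<close>)
  have \<delta>_step: "\<delta> (Suc n) dvd \<delta> n \<and> \<delta> (Suc n) \<noteq> \<delta> n" if n: "n < N" for n
  proof (rule \<delta>_cases[of n])
    fix i assume i: "i \<le> e" "n = 2 * i"
    then show ?thesis using dvd_\<alpha>_\<beta>[of i] \<alpha>_\<beta>_neq[of i i] assms(1) by (simp add: \<delta>_\<beta> \<delta>_\<alpha>_low)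
  next
    fix i assume i: "i \<le> e" "n = Suc (2 * i)"
    \<comment> \<open>The \<beta> entries end at \<open>\<beta> e\<close>, so
      \<open>\<alpha> e\<close> is followed by \<open>\<alpha> (e + 1)\<close> and every earlier
      \<open>\<alpha> i\<close> by \<open>\<beta> (i + 1)\<close>.\<close>
    show ?thesis
    proof (cases "i = e")
      case True
      then have "\<delta> (Suc n) = \<alpha> (Suc i)" using \<delta>_\<alpha>_high[of "Suc i"] i by (simp add: mult_2)
      then show ?thesis
        using \<alpha>_chain[of i] inj_onD[OF dist(1), of "Suc i" i] n i True by (auto simp: \<delta>_\<alpha>_low N_def)
    next
      case False
      then have "\<delta> (Suc n) = \<beta> (Suc i)" using \<delta>_\<beta>[of "Suc i"] i by simp
      then show ?thesis
        using dvd_\<beta>_\<alpha>[of i] \<alpha>_\<beta>_neq[of i "Suc i"] assms(1) i False by (simp add: \<delta>_\<alpha>_low)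
    qed
  next
    fix i assume i: "e < i" "i \<le> d" "n = Suc (i + e)"
    then have "\<delta> (Suc n) = \<alpha> (Suc i)" using \<delta>_\<alpha>_high[of "Suc i"] by simp
    then show ?thesis
      using \<alpha>_chain[of i] inj_onD[OF dist(1), of "Suc i" i] n i by (auto simp: \<delta>_\<alpha>_high N_def)
  qed (use n in simp)
  obtain c' q where q: "is_qp_expansion c' q" "\<And>k. q (int k) = fps_nth (\<Prod>i\<le>N. geom_fps (\<delta> i)) k"
    "\<And>n. n \<le> N \<Longrightarrow> min_period (c' n) = \<delta> n"
    using prod_geom_fps_divisor_chain[of N \<delta>] \<delta>_pos \<delta>_step by metis
  \<comment> \<open>For natural \<open>k\<close> the convolution is the Cauchy product of the two
    generating functions, hence generated by the merged chain.\<close>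
  have "qp_convolution (ehrhart_qp \<Delta>1) (ehrhart_qp \<Delta>2) = q"
  proof (rule qp_convolution_eq)
    show "quasi_polynomial q" using q(1) by (auto simp: quasi_polynomial_def)
    fix k
    have "(\<Sum>m=0..k. ehrhart_qp \<Delta>1 (int k - int m) * ehrhart_qp \<Delta>2 (int m))
        = (\<Sum>m=0..k. fps_nth (\<Prod>i\<le>d. geom_fps (\<alpha> i)) (k - m) * fps_nth (\<Prod>i\<le>e. geom_fps (\<beta> i)) m)"
      by (intro sum.cong refl arg_cong2[of _ _ _ _ "(*)"])
        (simp_all add: ehr2(1) flip: ehr1(1) of_nat_diff)
    also have "\<dots> = fps_nth ((\<Prod>i\<le>e. geom_fps (\<beta> i)) * (\<Prod>i\<le>d. geom_fps (\<alpha> i))) k"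
      unfolding fps_mult_nth by (intro sum.cong refl mult.commute)
    also have "\<dots> = q (int k)"
      unfolding q(2) N_def \<delta>_def prod_interleave[OF assms(1)] by (simp only: mult.commute)
    finally show "q (int k) = (\<Sum>m=0..k. ehrhart_qp \<Delta>1 (int k - int m) * ehrhart_qp \<Delta>2 (int m))" ..
  qed
  then have \<gamma>: "\<gamma> n = \<delta> n" if "n \<le> N" for n
    using assms(16,19) q(3) qp_coeff_eq[OF q(1)] that by simp

  have \<delta>_dvd: "\<delta> m dvd \<delta> n" if "n \<le> m" "m \<le> N" for n m
    using that
  proof (induction m rule: dec_induct)
    case (step m)
    then show ?case using \<delta>_step[of m] by (auto intro: dvd_trans[of _ "\<delta> m"])
  qed simp
  \<comment> \<open>the position of \<alpha> i in the merged chain; that of \<beta> i is 2 * i\<close>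
  define pos where "pos i = Suc (i + min i e)" for i
  have pos: "\<alpha> i = \<delta> (pos i)" "pos i \<le> N" if "i \<le> d" for i
    using that \<delta>_\<alpha>_low[of i] \<delta>_\<alpha>_high[of i]
    by (cases "i \<le> e"; simp add: pos_def N_def mult_2 min_def)+
  show ?thesis
  proof (cases "j = - 1")
    case True
    \<comment> \<open>Here \<open>j + 1 = 0\<close>, so the set contains \<open>\<beta>h 0\<close>,
      the top of the chain.\<close>
    have "Lcm ({\<alpha>h i | i. j + 1 \<le> int i \<and> i \<le> d} \<union> {\<beta>h i | i. j + 1 \<le> int i \<and> i \<le> e} \<union> {g j}) = \<delta> 0"
    proof (rule Lcm_eq_top)
      have "\<delta> 0 = \<beta>h 0" using \<beta>h \<delta>_\<beta>[of 0] by simp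
      then show "\<delta> 0 \<in> {\<alpha>h i | i. j + 1 \<le> int i \<and> i \<le> d} \<union> {\<beta>h i | i. j + 1 \<le> int i \<and> i \<le> e} \<union> {g j}"
        using True by auto
      fix x assume "x \<in> {\<alpha>h i | i. j + 1 \<le> int i \<and> i \<le> d} \<union> {\<beta>h i | i. j + 1 \<le> int i \<and> i \<le> e} \<union> {g j}"
      then show "x dvd \<delta> 0"
        using True assms(1,20) \<delta>_dvd[of 0] pos \<delta>_\<beta>[symmetric] by (auto simp: \<alpha>h \<beta>h N_def)
    qed
    then show ?thesis using True \<gamma>[of 0] by simp
  next
    case False
    define n where "n = nat j"
    have j: "j = int n" "n \<le> d + e" using False assms(22,23) by (simp_all add: n_def)
    \<comment> \<open>Of two entries the one at the later position divides the other and so is the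
      gcd.\<close>
    have gcd: "gcd (\<alpha>h i) (\<beta>h l) = \<delta> (max (pos i) (2 * l))" if "i \<le> d" "l \<le> e" for i l
    proof -
      have "2 * l \<le> N" using that assms(1) by (simp add: N_def)
      then show ?thesis
        using that pos[of i] \<delta>_dvd[of "pos i" "2 * l"] \<delta>_dvd[of "2 * l" "pos i"]
        by (cases "pos i \<le> 2 * l") (simp_all add: \<alpha>h \<beta>h \<delta>_\<beta>[symmetric] max_def gcd_nat.absorb1 gcd_nat.absorb2)
    qed
    \<comment> \<open>The lcm belongs to the least value of \<open>max (pos i) (2 * l)\<close> over
      \<open>i + l = n\<close>. This is at least \<open>n + 1\<close>: for \<open>i \<le> e\<close>
      the two numbers add up to \<open>2 * n + 1\<close>, and for \<open>i > e\<close> already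
      \<open>pos i = i + e + 1 \<ge> n + 1\<close>.\<close>
    have g: "g j = \<delta> (Suc n)"
    proof -
      \<comment> \<open>The bound is attained with \<open>i\<close> and \<open>l\<close> as equal as
        possible while \<open>n \<le> 2 * e\<close>, and with \<open>l = e\<close> beyond
        that.\<close>
      have "\<exists>i l. i \<le> d \<and> l \<le> e \<and> i + l = n \<and> max (pos i) (2 * l) = Suc n"
      proof (cases "n \<le> 2 * e")
        case True
        define i where "i = n div 2"
        have "n = 2 * i \<or> n = Suc (2 * i)" unfolding i_def by linarith
        then show ?thesis
        proof
          assume "n = 2 * i"
          then show ?thesis using True assms(1) by (intro exI[of _ i]) (auto simp: pos_def)
        next
          assume "n = Suc (2 * i)"
          then show ?thesis using True assms(1)
            by (intro exI[of _ i] exI[of _ "Suc i"]) (auto simp: pos_def)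
        qed
      next
        case False
        then show ?thesis using j(2) by (intro exI[of _ "n - e"] exI[of _ e]) (auto simp: pos_def)
      qed
      then obtain i l where il: "i \<le> d" "l \<le> e" "i + l = n" "max (pos i) (2 * l) = Suc n" by blast
      have "Lcm {gcd (\<alpha>h i) (\<beta>h l) | i l. i \<le> d \<and> l \<le> e \<and> int i + int l = j} = \<delta> (Suc n)"
      proof (rule Lcm_eq_top)
        show "\<delta> (Suc n) \<in> {gcd (\<alpha>h i) (\<beta>h l) | i l. i \<le> d \<and> l \<le> e \<and> int i + int l = j}"
          using il gcd[of i l] j(1) by force
        fix x assume "x \<in> {gcd (\<alpha>h i) (\<beta>h l) | i l. i \<le> d \<and> l \<le> e \<and> int i + int l = j}"
        then obtain i l where il: "x = gcd (\<alpha>h i) (\<beta>h l)" "i \<le> d" "l \<le> e" "i + l = n"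
          using j(1) by auto
        have "Suc n \<le> max (pos i) (2 * l)" "max (pos i) (2 * l) \<le> N"
          using il assms(1) by (auto simp: pos_def N_def)
        then show "x dvd \<delta> (Suc n)" using \<delta>_dvd gcd il by simp
      qed
      then show ?thesis using assms(21)[of j] j by simp
    qed
    \<comment> \<open>For \<open>i \<ge> n + 1\<close> the entry \<open>\<alpha> i\<close> stands at
      \<open>pos i > n + 1\<close> and \<open>\<beta> i\<close> at \<open>2 * i \<ge> n + 1\<close>,
      so all members divide \<open>g j\<close>.\<close>
    have "Lcm ({\<alpha>h i | i. j + 1 \<le> int i \<and> i \<le> d} \<union> {\<beta>h i | i. j + 1 \<le> int i \<and> i \<le> e} \<union> {g j}) = \<delta> (Suc n)"
    proof (rule Lcm_eq_top)
      fix x assume "x \<in> {\<alpha>h i | i. j + 1 \<le> int i \<and> i \<le> d} \<union> {\<beta>h i | i. j + 1 \<le> int i \<and> i \<le> e} \<union> {g j}"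
      then consider i where "x = \<alpha> i" "Suc n \<le> i" "i \<le> d" | i where "x = \<beta> i" "Suc n \<le> i" "i \<le> e"
        | "x = \<delta> (Suc n)"
        using j(1) g \<alpha>h \<beta>h by auto
      then show "x dvd \<delta> (Suc n)"
      proof cases
        case (1 i)
        then show ?thesis using pos[of i] \<delta>_dvd[of "Suc n" "pos i"] by (simp add: pos_def)
      next
        case (2 i)
        then show ?thesis using \<delta>_\<beta>[of i] \<delta>_dvd[of "Suc n" "2 * i"] assms(1) by (simp add: N_def)
      qed simp
    qed (simp add: g)
    moreover have "nat (j + 1) = Suc n" "Suc n \<le> N" using j by (simp_all add: N_def)
    ultimately show ?thesis using \<gamma>[of "Suc n"] by simp
  qed
qed

end
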